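(* Let $(F_n)_{n\ge 0}$ and $(L_n)_{n\ge 0}$ be the Fibonacci and Lucas sequences. The Fibonacci numbers which are concatenations of a Fibonacci number and a Lucas number (in this order) are exactly $1, 2, 3, 13, 21$ and $34$. That is, the set of all integers $F_n$ with $n \ge 0$ for which there exist integers $m, k \ge 0$ such that $$F_n = 10^d F_m + L_k,$$ where $d$ is the number of decimal digits of $L_k$, is equal to $\{1, 2, 3, 13, 21, 34\}$.
   Context: The Fibonacci sequence is defined by $F_0=0$, $F_1=1$, $F_{n+2}=F_{n+1}+F_n$ for $n\ge 0$. The Lucas sequence is defined by $L_0=2$, $L_1=1$, $L_{n+2}=L_{n+1}+L_n$ for $n\ge 0$. For non-negative integers $a,b$, the concatenation $\overline{ab}$ is the integer $10^d a + b$, where $d$ is the number of decimal digits of $b$ (for $b \geq 1$, $d=\lfloor \log_{10} b\rfloor+1$). The case $a=0$ is allowed, so that $\overline{0b}=b$. *)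

theory Defs
  imports "HOL-Number_Theory.Fib" "HOL-Library.Log_Nat"
begin

fun lucas :: "nat \<Rightarrow> nat" where
  "lucas 0 = 2"
| "lucas (Suc 0) = 1"
| "lucas (Suc (Suc n)) = lucas (Suc n) + lucas n"

(* For b >= 1, floorlog 10 b is the floor of log 10 b, plus 1. The numeral of 0 has one digit,
   whereas floorlog 10 0 = 0. *)
definition num_digits :: "nat \<Rightarrow> nat" where
  "num_digits b = (if b = 0 then 1 else floorlog 10 b)"

definition concatenation :: "nat \<Rightarrow> nat \<Rightarrow> nat" where
  "concatenation a b = 10 ^ num_digits b * a + b"

end

theory Submission
  imports Defs
begin

text \<open>
  Write the equation as $F_n = 10^d F_m + L_k$ with $m \ge 2$. Comparing sizes gives $n = m + k + t$
  with $0 \le t \le 6$. No linear forms in logarithms are needed, because the equation modulo $F_m$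
  already bounds $m$: modulo $F_m$ both $F_{m+k+t}$ and $L_k$ are multiplied by $F_{m-1}$ when $k$
  grows by $m$, so $F_m$ divides $F_{m+r+t} - L_r$ for the remainder $r$ of $k$ modulo $m$, and
  $F_{m+s} = L_s F_m \pm F_{|m-s|}$ turns this into a divisibility between numbers of the size of
  $F_m$. As $L_r$ is not a Fibonacci number for $r \ge 3$, this forces $m \le 12$. For these $m$
  and $d \ge 3$ the equation has no solution modulo $54120 = 2^3 \cdot 3 \cdot 5 \cdot 11 \cdot 41$,
  a modulus for which the Fibonacci numbers have period 120 and the powers of ten from $10^3$ on
  have period 10. The cases $d \le 2$ are finitely many.
\<close>

section \<open>Fibonacci and Lucas identities\<close>

text \<open>Kept general because it serves both \<open>lucas\<close> and, for the period 120,
  differences of Fibonacci and Lucas sequences.\<close>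

lemma fib_recurrence_add:
  fixes f :: "nat \<Rightarrow> int"
  assumes "\<And>n. f (Suc (Suc n)) = f (Suc n) + f n"
  shows "f (n + Suc k) = int (fib (Suc k)) * f (Suc n) + int (fib k) * f n"
  by (induct k rule: fib.induct) (simp_all add: assms algebra_simps)

lemma lucas_eq_fib: "int (lucas n) = 2 * int (fib (Suc n)) - int (fib n)"
  by (induct n rule: fib.induct) simp_all

lemma lucas_Suc_eq_fib: "lucas (Suc n) = fib n + fib (Suc (Suc n))"
  using lucas_eq_fib[of "Suc n"] by simp

lemma lucas_add: "int (lucas (n + Suc k)) = int (fib (Suc k)) * lucas (Suc n) + int (fib k) * lucas n"
  by (rule fib_recurrence_add) simp

lemma fib_Cassini_diff: "(int (fib (Suc n)))\<^sup>2 - fib (Suc n) * fib n - (int (fib n))\<^sup>2 = (-1) ^ n"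
  using fib_Cassini_int[of n] by (simp add: power2_eq_square algebra_simps)

text \<open>Besides the two identities below, this gives \<open>fib 120\<close> from
  \<open>fib 15\<close> in three doublings.\<close>

lemma fib_double:
  "int (fib (n + n)) = int (fib n) * (2 * int (fib (Suc n)) - int (fib n))"
  "int (fib (Suc (n + n))) = (int (fib n))\<^sup>2 + (int (fib (Suc n)))\<^sup>2"
proof -
  show *: "int (fib (Suc (n + n))) = (int (fib n))\<^sup>2 + (int (fib (Suc n)))\<^sup>2"
    by (simp only: fib_add) (simp add: power2_eq_square)
  have "int (fib (Suc (n + Suc n))) = fib (Suc (Suc n)) * fib (Suc n) + fib (Suc n) * fib n"
    by (simp only: fib_add)
  then show "int (fib (n + n)) = int (fib n) * (2 * int (fib (Suc n)) - int (fib n))"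
    using * by (simp add: power2_eq_square algebra_simps)
qed

text \<open>Both sides satisfy the Fibonacci recurrence in \<open>i\<close>, so \<open>i = 0\<close>
  (doubling) and \<open>i = 1\<close> (doubling and Cassini) suffice.\<close>

lemma fib_lucas_minus:
  "int (fib (2 * j + i)) = int (lucas j) * fib (j + i) - (-1) ^ j * int (fib i)"
proof (induct i rule: fib.induct)
  case 1
  then show ?case
    using fib_double(1)[of j, folded mult_2] by (simp add: lucas_eq_fib mult.commute)
next
  case 2
  have "int (fib (Suc (j + j))) = int (lucas j) * fib (Suc j) - (-1) ^ j"
    unfolding fib_double(2) lucas_eq_fib fib_Cassini_diff[of j, symmetric]
    by (simp add: power2_eq_square algebra_simps)
  then show ?case by (simp add: mult_2)
next
  case (3 i)
  then show ?case by (simp add: distrib_left right_diff_distrib)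
qed

lemma fib_lucas_plus:
  "int (fib (2 * j + i)) = int (lucas (j + i)) * fib j + (-1) ^ j * int (fib i)"
proof (induct i rule: fib.induct)
  case 1
  then show ?case
    using fib_double(1)[of j, folded mult_2] by (simp add: lucas_eq_fib mult.commute)
next
  case 2
  have "int (fib (Suc (j + j))) = int (lucas (Suc j)) * fib j + (-1) ^ j"
    unfolding fib_double(2) lucas_eq_fib[of "Suc j"] fib_Cassini_diff[of j, symmetric]
    by (simp add: power2_eq_square algebra_simps)
  then show ?case by (simp add: mult_2)
next
  case (3 i)
  then show ?case by (simp add: algebra_simps)
qed

text \<open>With truncated subtraction, \<open>m - s + (s - m)\<close> is the distance of
  \<open>m\<close> and \<open>s\<close>. The sign of \<open>e\<close> depends on parities and is
  hidden, since only the size of \<open>e\<close> matters later.\<close>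

lemma fib_add_eq_lucas_mult:
  obtains e :: int where "int (fib (m + s)) = int (lucas s) * fib m + e"
    and "\<bar>e\<bar> = fib (m - s + (s - m))"
proof (cases "s \<le> m")
  case True
  then show ?thesis
    using that[of "- ((-1) ^ s * int (fib (m - s)))"] fib_lucas_minus[of s "m - s"]
    by (simp add: abs_mult add.commute)
next
  case False
  then show ?thesis
    using that[of "(-1) ^ m * int (fib (s - m))"] fib_lucas_plus[of m "s - m"]
    by (simp add: abs_mult)
qed

section \<open>Lucas numbers between Fibonacci numbers\<close>

lemma lucas_less_fib: "3 \<le> r \<Longrightarrow> fib (Suc r) < lucas r \<and> lucas r < fib (Suc (Suc r))"
proof -
  assume "3 \<le> r"
  then obtain q where "r = q + 3" by (metis add.commute le_Suc_ex)
  moreover have "0 < fib (Suc q)" by (simp add: fib_neq_0_nat)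
  ultimately show ?thesis by (simp add: lucas_Suc_eq_fib eval_nat_numeral)
qed

lemma lucas_neq_fib:
  assumes "3 \<le> r" shows "lucas r \<noteq> fib u"
proof (cases "u \<le> Suc r")
  case True
  then show ?thesis using lucas_less_fib[OF assms] fib_mono[OF True] by simp
next
  case False
  then have "Suc (Suc r) \<le> u" by simp
  from fib_mono[OF this] show ?thesis using lucas_less_fib[OF assms] by simp
qed

lemma lucas_pos: "0 < lucas n"
  by (induct n rule: fib.induct) simp_all

text \<open>The summand 1 is there for \<open>r = 0\<close>, where \<open>lucas 0 = 2\<close> and
  \<open>fib 2 = 1\<close>.\<close>

lemma lucas_le_fib: "lucas r \<le> fib (r + 2) + 1"
proof (cases "3 \<le> r")
  case True
  then show ?thesis using lucas_less_fib[of r] by simp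
next
  case False
  then have "r = 0 \<or> r = 1 \<or> r = 2" by auto
  then show ?thesis by (auto simp: eval_nat_numeral)
qed

lemma lucas_mono: "1 \<le> i \<Longrightarrow> i \<le> j \<Longrightarrow> lucas i \<le> lucas j"
  by (cases i; cases j) (auto simp: lucas_Suc_eq_fib intro!: add_mono fib_mono)

section \<open>Bounding \<open>m\<close> by divisibility by \<open>fib m\<close>\<close>

text \<open>Removing a multiple of \<open>fib m\<close> leaves \<open>lucas r - e\<close> with
  \<open>e\<close> a Fibonacci number up to sign. Apart from two extreme cases this is smaller than
  \<open>fib m\<close> in absolute value, so it would have to vanish, and it does not.\<close>

lemma not_fib_dvd_diff:
  assumes m: "13 \<le> m" and r: "r < m" and t: "t \<le> 6"
  shows "\<not> int (fib m) dvd int (fib (m + (r + t))) - int (lucas r)"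
proof
  assume dvd: "int (fib m) dvd int (fib (m + (r + t))) - int (lucas r)"
  define s where "s = r + t"
  obtain e :: int where e: "int (fib (m + s)) = int (lucas s) * fib m + e"
      "\<bar>e\<bar> = fib (m - s + (s - m))"
    by (rule fib_add_eq_lucas_mult)
  have "int (fib m) dvd int (lucas s) * fib m - (int (fib (m + s)) - int (lucas r))"
    by (rule dvd_diff[OF dvd_triv_right dvd[folded s_def]])
  then have dvd': "int (fib m) dvd int (lucas r) - e"
    using e(1) by (simp add: algebra_simps)
  have small: "int (lucas r) - e = 0" if "\<bar>int (lucas r) - e\<bar> < int (fib m)"
    using dvd_imp_le_int[OF _ dvd'] that by fastforce
  \<comment> \<open>The bound \<open>13 \<le> m\<close> gives \<open>fib p \<ge> 34\<close>, which
    absorbs all additive constants below. For \<open>r \<le> p\<close>, \<open>lucas r\<close> is at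
    most \<open>fib (m - 2) + 1\<close>; for the three larger \<open>r\<close>, \<open>s\<close> is
    within 5 of \<open>m\<close>, so \<open>e\<close> is tiny.\<close>
  define p where "p = m - 4"
  have p: "m = p + 4" "9 \<le> p" using m by (simp_all add: p_def)
  have f9: "fib 9 = 34" by code_simp
  have f: "fib p \<ge> 34" "fib (Suc p) \<ge> fib p" "fib (p + 2) = fib (Suc p) + fib p"
      "fib (p + 3) = fib (p + 2) + fib (Suc p)" "fib m = fib (p + 3) + fib (p + 2)"
    using fib_mono[OF p(2)] f9 by (simp_all add: p(1) fib_Suc_mono eval_nat_numeral)
  have small_fib: "fib 2 = 1" "fib 5 = 5" "fib 7 = 13" by code_simp+
  consider "r = 0" | "1 \<le> r" "r \<le> p" "s \<le> m" | "1 \<le> r" "r \<le> p" "m < s" | "p < r" by linarith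
  then show False
  proof cases
    case 1
    then have s: "s \<le> 6" using t by (simp add: s_def)
    then have e': "\<bar>e\<bar> = fib (m - s)" using e m by simp
    have "fib 7 \<le> fib (m - s)" using s m by (intro fib_mono) simp
    then have e7: "13 \<le> \<bar>e\<bar>" using e' small_fib by simp
    show False
    proof (cases "s = 0")
      case True
      then have "\<bar>e\<bar> = int (fib m)" using e' by simp
      then have "int (fib m) dvd e" by (metis dvd_abs_iff dvd_refl)
      with dvd' have "int (fib m) dvd int (lucas r) - e + e" by (rule dvd_add)
      then have "int (fib m) \<le> 2" using 1 by (intro zdvd_imp_le) simp_all
      then show False using f by simp
    next
      case False
      then have "fib (m - s) \<le> fib (p + 3)" using p by (intro fib_mono) simp
      then have "int (fib (m - s)) \<le> fib (p + 3)" by simp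
      moreover have "\<bar>int (lucas r) - e\<bar> \<le> 2 + \<bar>e\<bar>"
        using 1 abs_triangle_ineq4[of 2 e] by simp
      moreover have "int (fib m) = fib (p + 3) + fib (p + 2)" "2 < int (fib (p + 2))"
        using f by simp_all
      ultimately have "int (lucas r) - e = 0"
        using small e' by linarith
      then show False using e7 1 by simp
    qed
  next
    case 2
    have e': "\<bar>e\<bar> = fib (m - s)" using e 2 by simp
    have L: "lucas r < fib (p + 2) + 2"
      using lucas_le_fib[of r] fib_mono[of "r + 2" "p + 2"] 2 by simp
    have "int (lucas r) + \<bar>e\<bar> < int (fib m)"
    proof (cases "r = 1")
      case True
      then have "fib (m - s) \<le> fib (p + 3)" using p by (intro fib_mono) (simp add: s_def)
      then show ?thesis using e' True f by simp
    next
      case False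
      then have "fib (m - s) \<le> fib (p + 2)" using p 2 by (intro fib_mono) (simp add: s_def)
      then show ?thesis using e' L f by simp
    qed
    then have eq: "int (lucas r) = e" using small by simp
    then have eq': "lucas r = fib (m - s)" using e' by simp
    then have r2: "r \<le> 2" using lucas_neq_fib[of r] by (cases "r \<le> 2") auto
    then have "r = 1 \<or> r = 2" using 2 by auto
    then have "lucas r \<le> 3" by (auto simp: eval_nat_numeral)
    moreover have "5 \<le> m - s" using m t r2 by (simp add: s_def)
    ultimately show False using fib_mono[of 5 "m - s"] small_fib eq' by simp
  next
    case 3
    then have s: "s \<le> m + 2" "7 \<le> r" using t p by (simp_all add: s_def)
    have "fib (m - s + (s - m)) \<le> fib 2" using 3 s by (intro fib_mono) simp
    then have e': "\<bar>e\<bar> \<le> 1" using e small_fib by simp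
    have "lucas 3 \<le> lucas r" using s by (intro lucas_mono) simp_all
    then have "4 \<le> lucas r" by (simp add: eval_nat_numeral)
    moreover have "lucas r < fib (p + 2) + 2"
      using lucas_le_fib[of r] fib_mono[of "r + 2" "p + 2"] 3 by simp
    ultimately have "4 \<le> int (lucas r)" "int (lucas r) < int (fib (p + 2)) + 2"
      by linarith+
    moreover have "int (fib m) = fib (p + 3) + fib (p + 2)" "2 < int (fib (p + 3))"
      using f by simp_all
    ultimately show False using small e' by linarith
  next
    case 4
    have "fib (m - s + (s - m)) \<le> fib 5" using 4 r t p by (intro fib_mono) (simp add: s_def)
    then have e': "\<bar>e\<bar> \<le> 5" using e small_fib by simp
    have L: "fib (p + 2) < lucas r"
      using lucas_less_fib[of r] fib_mono[of "p + 2" "Suc r"] 4 p by simp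
    have L1: "lucas (p + 3) = fib (p + 2) + fib m"
      using lucas_Suc_eq_fib[of "p + 2"] p by (simp add: eval_nat_numeral)
    have "lucas (p + 2) = fib (p + 1) + fib (p + 3)"
      using lucas_Suc_eq_fib[of "p + 1"] by (simp add: eval_nat_numeral)
    moreover have "lucas r \<le> lucas (p + 2)" if "r \<noteq> p + 3"
      using that r p 4 by (intro lucas_mono) simp_all
    ultimately have L2: "lucas r \<le> fib (p + 1) + fib (p + 3)" if "r \<noteq> p + 3" using that by simp
    show False
    proof (cases "r = p + 3")
      \<comment> \<open>For \<open>r = m - 1\<close> the value \<open>lucas r\<close> exceeds
        \<open>fib m\<close>. After subtracting \<open>fib m\<close> once,
        \<open>fib (m - 2) - e\<close> remains, strictly between 0 and \<open>fib m\<close>.\<close>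
      case True
      have "int (fib m) dvd int (lucas r) - e - fib m"
        by (rule dvd_diff[OF dvd' dvd_refl])
      then have "int (fib m) \<le> int (lucas r) - e - fib m"
        using True L1 f e' by (intro zdvd_imp_le) simp_all
      then show False using True L1 f e' by simp
    next
      case False
      then have "int (lucas r) \<le> int (fib (p + 1)) + int (fib (p + 3))"
        "int (fib (p + 2)) < int (lucas r)"
        using L2 L by linarith+
      moreover have "int (fib m) = fib (p + 3) + fib (p + 2)" "5 < int (fib (p + 2))"
          "int (fib (p + 1)) + 5 < int (fib (p + 2))"
        using f by simp_all
      ultimately show False using small e' by linarith
    qed
  qed
qed

text \<open>Lowering \<open>k\<close> by \<open>m\<close> removes the factor
  \<open>fib (m - 1)\<close> modulo \<open>fib m\<close>; it can be cancelled because consecutive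
  Fibonacci numbers are coprime.\<close>

lemma fib_dvd_diff_mod:
  assumes "int (fib m) dvd int (fib (m + (k + t))) - int (lucas k)" and m: "2 \<le> m"
  shows "int (fib m) dvd int (fib (m + (k mod m + t))) - int (lucas (k mod m))"
  using assms(1)
proof (induct k rule: less_induct)
  case (less k)
  show ?case
  proof (cases "k < m")
    case True
    then show ?thesis using less by simp
  next
    case False
    define i where "i = k - m"
    have k: "k = i + m" using False by (simp add: i_def)
    obtain q where q: "m = Suc q" using m by (cases m) auto
    have "int (fib (m + (k + t))) = int (fib (Suc ((m + (i + t)) + q)))"
      by (simp add: k q ac_simps)
    then have F: "int (fib (m + (k + t))) = int (fib m) * fib (Suc (m + (i + t))) + int (fib q) * fib (m + (i + t))"
      by (simp only: fib_add of_nat_add of_nat_mult q)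
    have L: "int (lucas k) = int (fib m) * lucas (Suc i) + int (fib q) * lucas i"
      using lucas_add[of i q] by (simp add: k q)
    have "int (fib m) dvd int (fib m) * (int (fib (Suc (m + (i + t)))) - lucas (Suc i))"
      by simp
    then have "int (fib m) dvd (int (fib (m + (k + t))) - int (lucas k))
        - int (fib m) * (int (fib (Suc (m + (i + t)))) - lucas (Suc i))"
      using less.prems by (rule dvd_diff[rotated])
    also have "(int (fib (m + (k + t))) - int (lucas k))
        - int (fib m) * (int (fib (Suc (m + (i + t)))) - lucas (Suc i))
        = int (fib q) * (int (fib (m + (i + t))) - lucas i)"
      unfolding F L by (simp only: algebra_simps)
    finally have "int (fib m) dvd int (fib q) * (int (fib (m + (i + t))) - lucas i)" .
    moreover have "coprime (int (fib m)) (int (fib q))"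
      using coprime_fib_Suc_nat[of q] by (simp add: q coprime_commute)
    ultimately have "int (fib m) dvd int (fib (m + (i + t))) - lucas i"
      by (simp add: coprime_dvd_mult_right_iff)
    then have "int (fib m) dvd int (fib (m + (i mod m + t))) - int (lucas (i mod m))"
      using less.hyps[of i] k m by simp
    then show ?thesis by (simp add: k)
  qed
qed

section \<open>The sieve modulo 54120\<close>

text \<open>
  Binary integers, because \<open>code_simp\<close> evaluates natural numbers in unary.
\<close>

fun fib_from :: "int \<Rightarrow> int \<Rightarrow> nat \<Rightarrow> int" where
  "fib_from a b 0 = a"
| "fib_from a b (Suc n) = fib_from b (a + b) n"

lemma fib_from_eq:
  fixes f :: "nat \<Rightarrow> int"
  assumes "\<And>n. f (Suc (Suc n)) = f (Suc n) + f n"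
  shows "fib_from (f k) (f (Suc k)) n = f (k + n)"
proof (induct n arbitrary: k)
  case (Suc n)
  then show ?case
    using Suc[of "Suc k"] by (simp add: assms add.commute)
qed simp

lemma fib_eq_fib_from: "int (fib n) = fib_from 0 1 n"
  using fib_from_eq[of "\<lambda>n. int (fib n)" 0 n] by simp

lemma lucas_eq_fib_from: "int (lucas n) = fib_from 2 1 n"
  using fib_from_eq[of "\<lambda>n. int (lucas n)" 0 n] by simp

text \<open>
  The test modulo 40 only saves comparisons: all residues that have to be avoided are multiples of 40.
\<close>

fun avoids :: "int list \<Rightarrow> nat \<Rightarrow> int \<Rightarrow> int \<Rightarrow> bool" where
  "avoids S 0 x y \<longleftrightarrow> True"
| "avoids S (Suc n) x y \<longleftrightarrow> (if x mod 40 = 0 then x \<notin> set S else True) \<and>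
     avoids S n y (if x + y < 54120 then x + y else x + y - 54120)"

text \<open>Two residues below 54120 have a sum below twice the modulus, so one conditional
  subtraction reduces it. The hypothesis on \<open>S\<close> makes the pretest modulo 40
  lossless.\<close>

lemma avoidsD:
  fixes f :: "nat \<Rightarrow> int"
  assumes "avoids S n (f k mod 54120) (f (Suc k) mod 54120)" "i < n"
    and f: "\<And>n. f (Suc (Suc n)) = f (Suc n) + f n"
    and S: "\<And>x. x \<in> set S \<Longrightarrow> x mod 40 = 0"
  shows "f (k + i) mod 54120 \<notin> set S"
  using assms(1,2)
proof (induct n arbitrary: k i)
  case (Suc n)
  show ?case
  proof (cases i)
    case 0
    then show ?thesis using Suc.prems S by (auto split: if_splits)
  next
    case (Suc i')
    let ?x = "f k mod 54120" and ?y = "f (Suc k) mod 54120"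
    have "f (Suc (Suc k)) mod 54120 = (?x + ?y) mod 54120"
      by (simp add: f mod_add_eq add.commute)
    also have "\<dots> = (if ?x + ?y < 54120 then ?x + ?y else ?x + ?y - 54120)"
    proof -
      have "0 \<le> ?x" "?x < 54120" "0 \<le> ?y" "?y < 54120" by simp_all
      then show ?thesis
        using mod_pos_pos_trivial[of "?x + ?y" 54120] mod_pos_pos_trivial[of "?x + ?y - 54120" 54120]
        by (simp only: minus_mod_self2) auto
    qed
    finally have "avoids S n ?y (f (Suc (Suc k)) mod 54120)"
      using Suc.prems(1) by simp
    then show ?thesis
      using Suc.hyps[of "Suc k" i'] Suc Suc.prems(2) by simp
  qed
qed simp

text \<open>One full period: the residues of \<open>10 ^ 3\<close> to \<open>10 ^ 12\<close>. The
  factor \<open>2 ^ 3\<close> of the modulus delays periodicity to exponent 3.\<close>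

definition pow10_residues :: "int list" where
  "pow10_residues = [1000, 10000, 45880, 25840, 41920, 40360, 24760, 31120, 40600, 27160]"

lemma pow10_mod: "10 ^ (n + 3) mod 54120 \<in> set pow10_residues"
proof (induct n)
  case (Suc n)
  have "10 ^ (Suc n + 3) mod 54120 = (10 * 10 ^ (n + 3)) mod (54120::int)"
    by (simp only: add_Suc power_Suc)
  also have "\<dots> = (10 * (10 ^ (n + 3) mod 54120)) mod 54120"
    by (rule mod_mult_right_eq[symmetric])
  finally have eq: "10 ^ (Suc n + 3) mod 54120 = (10 * (10 ^ (n + 3) mod 54120)) mod (54120::int)" .
  have "\<forall>c\<in>set pow10_residues. 10 * c mod 54120 \<in> set pow10_residues"
    by code_simp
  then show ?case unfolding eq using Suc by blast
qed (simp add: pow10_residues_def)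

text \<open>Modulo 54120, \<open>fib 120\<close> is 0 and \<open>fib 119\<close> is 1, so by the
  addition formula a shift by 120 fixes every solution of the recurrence.\<close>

lemma fib_recurrence_period:
  fixes f :: "nat \<Rightarrow> int"
  assumes "\<And>n. f (Suc (Suc n)) = f (Suc n) + f n"
  shows "f n mod 54120 = f (n mod 120) mod 54120"
proof -
  have 15: "int (fib 15) = 610" "int (fib 16) = 987"
    unfolding fib_eq_fib_from by code_simp+
  have 30: "int (fib 30) = 832040" "int (fib 31) = 1346269"
    using fib_double[of 15] 15 by simp_all
  have 60: "int (fib 60) = 1548008755920" "int (fib 61) = 2504730781961"
    using fib_double[of 30] 30 by simp_all
  have 120: "int (fib 120) mod 54120 = 0" "int (fib 121) mod 54120 = 1"
    using fib_double[of 60] 60 by simp_all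
  have "fib 121 = fib 120 + fib 119"
    using fib.simps(3)[of 119] by simp
  then have "int (fib 119) - 1 = (int (fib 121) - 1) - int (fib 120)"
    by simp
  moreover have "54120 dvd int (fib 121) - 1" and dvd: "54120 dvd int (fib 120)"
    using 120 mod_eq_dvd_iff[of "int (fib 121)" 54120 1] by (simp_all add: mod_eq_0_iff_dvd)
  ultimately have "54120 dvd int (fib 119) - 1"
    by (metis dvd_diff)
  with dvd obtain a b where ab: "int (fib 120) = 54120 * a" "int (fib 119) - 1 = 54120 * b"
    by (meson dvdE)
  have period: "f (n + 120) mod 54120 = f n mod 54120" for n
  proof -
    have "f (n + 120) = int (fib 120) * f (Suc n) + (int (fib 119) - 1) * f n + f n"
      using fib_recurrence_add[of f n 119, OF assms] by (simp add: algebra_simps)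
    then have "f (n + 120) - f n = 54120 * (a * f (Suc n) + b * f n)"
      by (simp add: ab algebra_simps)
    then show ?thesis by (simp add: mod_eq_dvd_iff)
  qed
  have "f (n mod 120 + 120 * q) mod 54120 = f (n mod 120) mod 54120" for q
  proof (induct q)
    case (Suc q)
    then show ?case using period[of "n mod 120 + 120 * q"] by (simp add: ac_simps)
  qed simp
  from this[of "n div 120"] show ?thesis by simp
qed

text \<open>Here \<open>j\<close> stands for \<open>m + t\<close>. The range runs over the
  \<open>m\<close> from 2 to 12 for which \<open>t = j - m\<close> lies between 0 and 6, as all
  these pairs share one sequence in \<open>k\<close>.\<close>

definition sieve_residues :: "nat \<Rightarrow> int list" where
  "sieve_residues j = concat (map (\<lambda>m. map (\<lambda>c. c * fib_from 0 1 m mod 54120) pow10_residues)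
     [max 2 (j - 6)..<min 13 (Suc j)])"

text \<open>The start values are the terms \<open>k = 0\<close> and \<open>k = 1\<close> of
  \<open>fib (j + k) - lucas k\<close>, and 120 terms cover a period. The largest \<open>j\<close>
  is \<open>12 + 6\<close>.\<close>

lemma sieve:
  "\<forall>j \<in> set [2..<19]. avoids (sieve_residues j) 120
     ((fib_from 0 1 j - 2) mod 54120) ((fib_from 0 1 (Suc j) - 1) mod 54120)"
  by code_simp

lemma fib_diff_lucas_neq:
  assumes "2 \<le> m" "m \<le> 12" "t \<le> 6" "3 \<le> d"
  shows "int (fib (m + (k + t))) - int (lucas k) \<noteq> 10 ^ d * int (fib m)"
proof
  assume eq: "int (fib (m + (k + t))) - int (lucas k) = 10 ^ d * int (fib m)"
  define f where "f = (\<lambda>i. int (fib (m + t + i)) - int (lucas i))"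
  have f: "f (Suc (Suc n)) = f (Suc n) + f n" for n
    by (simp add: f_def)
  \<comment> \<open>Every entry of \<open>pow10_residues\<close> is a multiple of 40, and 40 divides
    54120, so reduction preserves this.\<close>
  have res: "x mod 40 = 0" if x: "x \<in> set (sieve_residues (m + t))" for x
  proof -
    obtain c i where "c \<in> set pow10_residues" "x = c * i mod 54120"
      using x by (auto simp: sieve_residues_def)
    moreover from this have "c mod 40 = 0"
      by (auto simp: pow10_residues_def)
    ultimately show ?thesis
      by (simp add: mod_mod_cancel mod_eq_0_iff_dvd)
  qed
  have "m + t \<in> set [2..<19]"
    unfolding set_upt using assms by simp
  from sieve[rule_format, OF this]
  have "avoids (sieve_residues (m + t)) 120 (f 0 mod 54120) (f (Suc 0) mod 54120)"
    by (simp add: f_def fib_eq_fib_from)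
  from avoidsD[OF this, of "k mod 120"] have "f (k mod 120) mod 54120 \<notin> set (sieve_residues (m + t))"
    using f res by simp
  moreover have "f (k mod 120) mod 54120 = 10 ^ d * int (fib m) mod 54120"
    using eq fib_recurrence_period[of f k] f by (simp add: f_def ac_simps)
  moreover have "10 ^ d * int (fib m) mod 54120 = (10 ^ d mod 54120) * int (fib m) mod 54120"
    by (simp add: mod_mult_left_eq)
  moreover have "10 ^ d mod 54120 \<in> set pow10_residues"
    using pow10_mod[of "d - 3"] assms(4) by simp
  then have "(10 ^ d mod 54120) * int (fib m) mod 54120 \<in> set (sieve_residues (m + t))"
    using assms unfolding sieve_residues_def
    by (auto simp: fib_eq_fib_from intro!: bexI[of _ m])
  ultimately show False by simp
qed

text \<open>\<open>lucas k\<close> has one digit for \<open>k < 5\<close> and two for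
  \<open>k\<close> from 5 to 9, so \<open>k\<close> determines the power of ten.\<close>

lemma small_cases:
  "\<forall>m \<in> set [2..<13]. \<forall>k \<in> set [0..<10]. \<forall>t \<in> set [0..<7].
     (if fib_from 0 1 (m + (k + t)) = (if k < 5 then 10 else 100) * fib_from 0 1 m + fib_from 2 1 k
      then fib_from 0 1 (m + (k + t)) \<in> set [1, 2, 3, 13, 21, 34] else True)"
  by code_simp

section \<open>From digit counts to index bounds\<close>

lemma concatenation_lucas_bounds:
  assumes "d = num_digits (lucas k)"
  shows "concatenation a (lucas k) = 10 ^ d * a + lucas k" "lucas k < 10 ^ d" "10 ^ d \<le> 10 * lucas k"
proof -
  have d: "d = floorlog 10 (lucas k)"
    using lucas_pos[of k] by (simp add: assms num_digits_def)
  moreover have "floorlog 10 (lucas k) \<noteq> 0"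
    using lucas_pos[of k] by (simp add: floorlog_eq_zero_iff)
  ultimately obtain d' where d': "d = Suc d'" using not0_implies_Suc by metis
  show "concatenation a (lucas k) = 10 ^ d * a + lucas k"
    by (simp add: concatenation_def assms)
  show "lucas k < 10 ^ d" "10 ^ d \<le> 10 * lucas k"
    using floorlog_bounds[of "lucas k" 10, folded d] lucas_pos[of k] by (simp_all add: d')
qed

text \<open>Let P be \<open>lucas k * fib m\<close>. The digit bounds give P < \<open>fib n\<close>
  \<le> 11 P, and P lies between \<open>fib (m + k - 1)\<close> and \<open>2 * fib (m + k)\<close>.
  The lower bounds yield \<open>m + k \<le> n\<close>; the upper ones yield
  \<open>fib n \<le> 22 * fib (m + k)\<close>.\<close>

lemma index_bounds:
  assumes eq: "fib n = 10 ^ d * fib m + lucas k"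
    and d: "lucas k < 10 ^ d" "10 ^ d \<le> 10 * lucas k" and m: "2 \<le> m"
  obtains t where "t \<le> 6" "n = m + (k + t)"
proof -
  have pos: "0 < fib m" using m by (simp add: fib_neq_0_nat)
  obtain q where q: "m = Suc q" using m by (cases m) auto
  have lower: "lucas k * fib m < fib n"
  proof -
    have "lucas k * fib m < 10 ^ d * fib m" using d pos by simp
    then show ?thesis unfolding eq by linarith
  qed
  have "fib (q + k) \<le> lucas k * fib m"
  proof (cases k)
    case 0
    then show ?thesis using fib_Suc_mono[of q] by (simp add: q)
  next
    case (Suc i)
    have "fib (q + k) = fib (Suc i) * fib m + fib i * fib q"
      by (simp add: Suc q fib_add)
    also have "\<dots> \<le> fib (Suc i) * fib m + fib i * fib m"
      using fib_Suc_mono[of q] by (simp add: q)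
    also have "\<dots> \<le> lucas k * fib m"
      by (simp add: Suc lucas_Suc_eq_fib algebra_simps)
    finally show ?thesis .
  qed
  with lower have "\<not> n \<le> q + k"
    using fib_mono[of n "q + k"] by linarith
  then have "m + k \<le> n" by (simp add: q)
  then obtain t where t: "n = m + k + t" by (metis le_Suc_ex)
  have "\<not> 7 \<le> t"
  proof
    assume "7 \<le> t"
    then have "fib (m + k + 7) \<le> fib n" by (intro fib_mono) (simp add: t)
    moreover have "fib (m + k + 7) = 13 * fib (Suc (m + k)) + 8 * fib (m + k)"
      by (simp add: eval_nat_numeral)
    \<comment> \<open>Thus \<open>fib (m + k + 7)\<close> is at least 27.5 times
      \<open>fib (m + k)\<close>, too large for the factor 22.\<close>
    moreover have "3 * fib (m + k) \<le> 2 * fib (Suc (m + k))"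
    proof -
      obtain v where v: "m + k = Suc (Suc v)" using m by (metis add.assoc add_2_eq_Suc le_Suc_ex)
      show ?thesis using fib_Suc_mono[of v] by (simp add: v)
    qed
    moreover have "lucas k * fib m \<le> 2 * fib (m + k)"
    proof -
      obtain e :: int where e: "int (fib (m + k)) = int (lucas k) * fib m + e"
          "\<bar>e\<bar> = fib (m - k + (k - m))"
        by (rule fib_add_eq_lucas_mult)
      have "fib (m - k + (k - m)) \<le> fib (m + k)" by (intro fib_mono) simp
      then have "int (lucas k * fib m) \<le> int (2 * fib (m + k))" using e by simp
      then show ?thesis by (simp only: of_nat_le_iff)
    qed
    moreover have "fib n \<le> 10 * (lucas k * fib m) + lucas k * fib m"
    proof -
      have "10 ^ d * fib m \<le> 10 * lucas k * fib m" using d by (intro mult_right_mono) simp_all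
      moreover have "lucas k * 1 \<le> lucas k * fib m" using pos by (intro mult_left_mono) simp_all
      ultimately show ?thesis unfolding eq by linarith
    qed
    moreover have "0 < fib (m + k)" using m by (simp add: fib_neq_0_nat)
    ultimately show False by linarith
  qed
  then show ?thesis using that[of t] t by simp
qed

section \<open>Assembling the classification\<close>

lemma fib_concatenation_cases:
  assumes eq: "fib n = concatenation (fib m) (lucas k)" and m: "2 \<le> m"
  shows "fib n \<in> {1, 2, 3, 13, 21, 34}"
proof -
  define d where "d = num_digits (lucas k)"
  note d = concatenation_lucas_bounds[OF d_def]
  have eq: "fib n = 10 ^ d * fib m + lucas k" using eq d(1) by simp
  obtain t where t: "t \<le> 6" "n = m + (k + t)"
    using index_bounds[OF eq d(2,3) m] .
  have diff: "int (fib (m + (k + t))) - int (lucas k) = 10 ^ d * int (fib m)"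
    using eq t(2) by simp
  then have "int (fib m) dvd int (fib (m + (k mod m + t))) - int (lucas (k mod m))"
    using m by (intro fib_dvd_diff_mod) simp_all
  then have m12: "m \<le> 12"
    using not_fib_dvd_diff[of m "k mod m" t] m t by fastforce
  have "\<not> 3 \<le> d" using fib_diff_lucas_neq diff m m12 t(1) by blast
  then have "d = 0 \<or> d = 1 \<or> d = 2" by auto
  then have d12: "d = 1 \<or> d = 2" using d(2) lucas_pos[of k] by auto
  have l5: "lucas 5 = 11" and l4: "lucas 4 = 7" and l10: "lucas 10 = 123"
    by (simp_all add: eval_nat_numeral)
  have k10: "k < 10"
    using lucas_mono[of 10 k] d12 d(2) l10 by (cases "k < 10") auto
  have k5: "k < 5" if "d = 1"
    using lucas_mono[of 5 k] that d(2) l5 by (cases "k < 5") auto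
  have k5': "5 \<le> k" if "d = 2"
  proof (rule ccontr)
    assume "\<not> 5 \<le> k"
    \<comment> \<open>Index 0 is separate because \<open>lucas 0 > lucas 1\<close> breaks
      monotonicity.\<close>
    then have "k = 0 \<or> lucas k \<le> lucas 4" by (cases k) (auto intro!: lucas_mono)
    then show False using that d(3) l4 by auto
  qed
  have "int (fib n) = (if k < 5 then 10 else 100) * int (fib m) + int (lucas k)"
    using d12 k5 k5' eq by auto
  moreover have "m \<in> set [2..<13]" "k \<in> set [0..<10]" "t \<in> set [0..<7]"
    unfolding set_upt using m m12 k10 t by simp_all
  ultimately have "int (fib n) \<in> set [1, 2, 3, 13, 21, 34]"
    using small_cases[rule_format, of m k t]
    by (simp only: fib_eq_fib_from lucas_eq_fib_from t(2) if_True)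
  then show ?thesis by auto
qed

theorem theorem1:
  shows "{N. \<exists>n. N = fib n \<and> (\<exists>m k. fib n = concatenation (fib m) (lucas k))}
           = {1, 2, 3, 13, 21, 34}"
    (is "?A = ?B")
proof
  show "?A \<subseteq> ?B"
  proof
    fix N assume "N \<in> ?A"
    then obtain n m k where N: "N = fib n" and eq: "fib n = concatenation (fib m) (lucas k)"
      by blast
    consider "m = 0" | "m = 1" | "2 \<le> m" by linarith
    then show "N \<in> ?B"
    proof cases
      case 1
      then have "fib n = lucas k" using eq by (simp add: concatenation_def)
      moreover from this have "k < 3" using lucas_neq_fib[of k n] by (cases "k < 3") auto
      then have "k = 0 \<or> k = 1 \<or> k = 2" by auto
      ultimately show ?thesis by (auto simp: N eval_nat_numeral)
    next
      case 2
      \<comment> \<open>As \<open>fib 1 = fib 2\<close>, index 1 is replaced by 2.\<close>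
      then show ?thesis
        using fib_concatenation_cases[of n 2 k] eq N by simp
    next
      case 3
      then show ?thesis using fib_concatenation_cases eq N by blast
    qed
  qed
  have mem: "fib n \<in> ?A" if "fib n = concatenation (fib m) (lucas k)" for n m k
    using that by blast
  \<comment> \<open>The splittings used are 0|1, 0|2, 0|3, 1|3, 2|1 and 3|4.\<close>
  have "fib 1 \<in> ?A" "fib 3 \<in> ?A" "fib 4 \<in> ?A" "fib 7 \<in> ?A" "fib 8 \<in> ?A" "fib 9 \<in> ?A"
    by (rule mem[of 1 0 1], code_simp, rule mem[of 3 0 0], code_simp, rule mem[of 4 0 2], code_simp,
        rule mem[of 7 1 2], code_simp, rule mem[of 8 3 1], code_simp, rule mem[of 9 4 3], code_simp)
  moreover have "fib 1 = 1" "fib 3 = 2" "fib 4 = 3" "fib 7 = 13" "fib 8 = 21" "fib 9 = 34"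
    by code_simp+
  ultimately show "?B \<subseteq> ?A"
    by (simp only: insert_subset empty_subsetI simp_thms)
qed

end
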